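(* Let $0<a<1$ and $b<1$ be real. For all $n,x\in\mathbb{Z}_{\ge0}$ the limit $$p_n^{a,b;0}(x):=\lim_{q\downarrow0}\,p_n^{a,b;q}(x)$$ exists, and the limit functions are given by $$p_0^{a,b;0}(x)=1\quad\text{for all }x\ge 0,$$ $$p_1^{a,b;0}(x)=\begin{cases}-\dfrac{a(1-b)}{1-a}&\text{if }x=0,\\ 1&\text{if }x>0,\end{cases}$$ and, for $n\ge2$, $$p_n^{a,b;0}(x)=\begin{cases}0&\text{if }0\le x<n-1,\\ -\dfrac{a}{1-a}&\text{if }x=n-1,\\ 1&\text{if }x>n-1.\end{cases}$$
   Context: For $0<q<1$ and $k\in\mathbb{Z}_{\ge0}$ write $(c;q)_k:=\prod_{i=0}^{k-1}(1-cq^i)$. For $0<q<1$, real $a,b$ with $0<a<1$ and $b<1$, and $n,x\in\mathbb{Z}_{\ge0}$, the (reparametrized) little $q$-Jacobi polynomials are $$p_n^{a,b;q}(x):={}_2\phi_1\left(q^{-n},abq^{n-1};a;q,q^{x+1}\right)=\sum_{k=0}^n\frac{(q^{-n};q)_k\,(abq^{n-1};q)_k}{(a;q)_k\,(q;q)_k}\,q^{(x+1)k}.$$ *)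

theory Defs
  imports Complex_Main
begin

definition q_pochhammer :: "real \<Rightarrow> real \<Rightarrow> nat \<Rightarrow> real" where
  "q_pochhammer c q k = (\<Prod>i<k. 1 - c * q ^ i)"

(* The factor q^(n-1) needs an integer exponent because it is q^(-1) for n = 0. *)
definition little_q_jacobi :: "real \<Rightarrow> real \<Rightarrow> real \<Rightarrow> nat \<Rightarrow> nat \<Rightarrow> real" where
  "little_q_jacobi a b q n x =
     (\<Sum>k\<le>n. q_pochhammer (q powi (- int n)) q k * q_pochhammer (a * b * q powi (int n - 1)) q k
            / (q_pochhammer a q k * q_pochhammer q q k) * q ^ ((x + 1) * k))"

(* Lim is meaningful only where the limit exists. *)
definition little_0_jacobi :: "real \<Rightarrow> real \<Rightarrow> nat \<Rightarrow> nat \<Rightarrow> real" where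
  "little_0_jacobi a b n x = Lim (at_right 0) (\<lambda>q. little_q_jacobi a b q n x)"

end

theory Submission
  imports Defs
begin

text \<open>
  For \<open>x \<ge> n - 1\<close> the powers of \<open>q\<close> in the hypergeometric sum are nonnegative, so the limit is
  obtained by putting \<open>q = 0\<close>; only the summands for \<open>k = 0\<close> and \<open>k = 1\<close> can survive. For
  \<open>x < n - 1\<close> the individual summands diverge. There one uses the second order \<open>q\<close>-difference
  equation in \<open>x\<close>: since its coefficient of \<open>p(x - 1)\<close> vanishes at \<open>x = 0\<close>, solving it upwards from
  \<open>x = 0\<close> gives \<open>p(x) = r\<^sub>x(q) p(x + 1)\<close> with \<open>r\<^sub>x(q) \<rightarrow> 0\<close>, and the limit \<open>0\<close> propagates
  downwards from the convergent value at \<open>x = n - 1\<close>.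
\<close>

section \<open>The second order q-difference equation\<close>

definition phi_coeff :: "real \<Rightarrow> real \<Rightarrow> real \<Rightarrow> real \<Rightarrow> nat \<Rightarrow> real" where
  "phi_coeff Q A a q k =
     q_pochhammer Q q k * q_pochhammer A q k / (q_pochhammer a q k * q_pochhammer q q k)"

text \<open>\<open>Q\<close> and \<open>A\<close> stand for \<open>q powi (- int n)\<close> and
  \<open>a * b * q powi (int n - 1)\<close>. A free real \<open>z\<close> makes sense of the value
  at \<open>z / q\<close> even for \<open>z = q\<close>, where \<open>z / q = 1\<close> is not of
  the form \<open>q ^ (x + 1)\<close>.\<close>

definition phi_sum :: "real \<Rightarrow> real \<Rightarrow> real \<Rightarrow> real \<Rightarrow> nat \<Rightarrow> real \<Rightarrow> real" where
  "phi_sum Q A a q n z = (\<Sum>k\<le>n. phi_coeff Q A a q k * z ^ k)"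

lemma little_q_jacobi_eq_phi_sum:
  "little_q_jacobi a b q n x =
     phi_sum (q powi (- int n)) (a * b * q powi (int n - 1)) a q n (q ^ (x + 1))"
  unfolding little_q_jacobi_def phi_sum_def phi_coeff_def by (simp only: power_mult)

lemma q_pochhammer_0 [simp]: "q_pochhammer c q 0 = 1"
  by (simp add: q_pochhammer_def)

lemma q_pochhammer_Suc: "q_pochhammer c q (Suc k) = q_pochhammer c q k * (1 - c * q ^ k)"
  by (simp add: q_pochhammer_def)

lemma mult_power_less_one:
  fixes a q :: real
  assumes "0 < q" "q < 1" "a < 1"
  shows "a * q ^ k < 1"
proof (cases "a \<le> 0")
  case True
  then have "a * q ^ k \<le> 0" using assms by (simp add: mult_nonpos_nonneg)
  then show ?thesis by simp
next
  case False
  have "a * q ^ k \<le> a * 1" using False assms by (intro mult_left_mono power_le_one) auto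
  then show ?thesis using assms by simp
qed

lemma phi_coeff_Suc:
  assumes "0 < q" "q < 1" "a < 1"
  shows "phi_coeff Q A a q (Suc k) * ((1 - a * q ^ k) * (1 - q ^ Suc k)) =
    phi_coeff Q A a q k * ((1 - Q * q ^ k) * (1 - A * q ^ k))"
proof -
  have "1 - a * q ^ k \<noteq> 0" "1 - q * q ^ k \<noteq> 0"
    using mult_power_less_one[of q a k] mult_power_less_one[of q q k] assms by auto
  then show ?thesis
    by (simp add: phi_coeff_def q_pochhammer_Suc divide_simps)
qed

text \<open>Applied to a monomial \<open>z ^ k\<close>, the difference of the two sides only has
  terms in \<open>z ^ k\<close> and \<open>z ^ Suc k\<close>. The recursion of the coefficients
  makes these cancel between neighbouring summands, so the sum telescopes.\<close>

lemma phi_sum_q_difference: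
  assumes q: "0 < q" "q < 1" and a: "a < 1" and QA: "Q * A * q = a * b" and Qn: "Q * q ^ n = 1"
  shows "(Q - 1) * (1 - A) * z * phi_sum Q A a q n z =
    a * (b * z / q - 1) * (phi_sum Q A a q n (q * z) - phi_sum Q A a q n z) +
    (z - q) * (phi_sum Q A a q n (z / q) - phi_sum Q A a q n z)"
proof -
  define c where "c = phi_coeff Q A a q"
  \<comment> \<open>This is the \<open>z ^ k\<close> part of the k-th summand; the
    \<open>z ^ Suc k\<close> part will turn out to be \<open>- T (Suc k)\<close>.\<close>
  define T where "T k = c k * z ^ k * ((1 - q ^ k) * (a - q / q ^ k))" for k
  have summand: "a * (b * z / q - 1) * (c k * (q * z) ^ k - c k * z ^ k) +
      (z - q) * (c k * (z / q) ^ k - c k * z ^ k) -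
      (Q - 1) * (1 - A) * z * (c k * z ^ k) = T k - T (Suc k)" for k
  proof -
    define u where "u = q ^ k"
    have u: "u \<noteq> 0" using q by (simp add: u_def)
    have ab: "a * b / q = Q * A" using QA q by (simp add: field_simps)
    have rec: "c (Suc k) * ((1 - a * u) * (1 - q * u)) = c k * ((1 - Q * u) * (1 - A * u))"
      using phi_coeff_Suc[OF q a, of Q A k] by (simp add: c_def u_def)
    have "T (Suc k) = - (z ^ Suc k / u) * (c (Suc k) * ((1 - a * u) * (1 - q * u)))"
      unfolding T_def using u q by (simp add: u_def[symmetric] field_simps)
    also have "\<dots> = - (z ^ Suc k / u) * (c k * ((1 - Q * u) * (1 - A * u)))"
      by (simp only: rec)
    finally have TS: "T (Suc k) = - (z ^ Suc k / u) * (c k * ((1 - Q * u) * (1 - A * u)))" .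
    have TT: "T k = c k * z ^ k * ((1 - u) * (a - q / u))"
      by (simp add: T_def u_def)
    have lin: "a * (b * z / q - 1) = Q * A * z - a"
      unfolding ab[symmetric] by (simp add: algebra_simps)
    show ?thesis
      unfolding TS TT lin power_mult_distrib power_divide u_def[symmetric]
      using u by (simp add: divide_simps) (simp add: algebra_simps)
  qed
  \<comment> \<open>The factor \<open>1 - Q * q ^ n\<close> vanishes, which closes the telescope at
    the top; at the bottom \<open>T 0 = 0\<close> because of \<open>1 - q ^ 0\<close>.\<close>
  have "c (Suc n) = 0"
    using Qn by (simp add: c_def phi_coeff_def q_pochhammer_Suc)
  then have "T 0 - T (Suc n) = 0" by (simp add: T_def)
  then have "(\<Sum>k\<le>n. T k - T (Suc k)) = 0" by (simp only: sum_telescope)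
  then show ?thesis
    unfolding summand[symmetric] phi_sum_def c_def
    by (simp add: sum.distrib sum_subtractf sum_distrib_left[symmetric])
qed

text \<open>At \<open>x = 0\<close> the truncated \<open>x - 1\<close> is harmless, because its coefficient vanishes.\<close>

lemma little_q_jacobi_q_difference:
  assumes q: "0 < q" "q < 1" and a: "a < 1" and x: "x + 1 < n"
  shows "(1 - q ^ n) * (1 - a * b * q ^ (n - 1)) * little_q_jacobi a b q n x =
    q ^ (n - 1 - x) *
      (a * (b * q ^ x - 1) * (little_q_jacobi a b q n (x + 1) - little_q_jacobi a b q n x) +
       q * (q ^ x - 1) * (little_q_jacobi a b q n (x - 1) - little_q_jacobi a b q n x))"
proof -
  define Q where "Q = q powi (- int n)"
  define A where "A = a * b * q ^ (n - 1)"
  define y where "y = little_q_jacobi a b q n"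
  \<comment> \<open>Multiplying by \<open>e\<close> turns \<open>z = q ^ (x + 1)\<close> into
    \<open>q ^ n\<close>, which cancels the pole of \<open>Q\<close>:
    \<open>(Q - 1) * q ^ n = 1 - q ^ n\<close>. The right-hand side gains a factor that vanishes as
    q \<rightarrow> 0.\<close>
  define e where "e = q ^ (n - 1 - x)"
  have powi: "q powi (int n - 1) = q ^ (n - 1)"
    using x by (simp add: power_int_def nat_diff_distrib)
  have Qn: "Q * q ^ n = 1" using q by (simp add: Q_def power_int_minus)
  have "q ^ n = q ^ (n - 1) * q"
    using x by (simp flip: power_Suc2)
  then have QA: "Q * A * q = a * b"
    using Qn by (simp add: A_def algebra_simps)
  have y_eq: "y x' = phi_sum Q A a q n (q ^ (x' + 1))" for x'
    by (simp add: y_def little_q_jacobi_eq_phi_sum powi A_def Q_def)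
  have "q ^ (x + 1) * e = q ^ (x + 1 + (n - 1 - x))"
    unfolding e_def by (simp only: power_add)
  also have "x + 1 + (n - 1 - x) = n" using x by simp
  finally have ze: "q ^ (x + 1) * e = q ^ n" .
  have down: "(q ^ (x + 1) - q) * phi_sum Q A a q n (q ^ (x + 1) / q) = (q ^ (x + 1) - q) * y (x - 1)"
    using q by (cases x) (simp_all add: y_eq)
  have "(1 - q ^ n) * (1 - A) * y x = e * ((Q - 1) * (1 - A) * q ^ (x + 1) * y x)"
  proof -
    have "e * ((Q - 1) * (1 - A) * q ^ (x + 1) * y x) =
        (Q - 1) * (1 - A) * (q ^ (x + 1) * e) * y x"
      by (simp only: ac_simps)
    also have "\<dots> = (Q * q ^ n - q ^ n) * (1 - A) * y x"
      unfolding ze by (simp add: algebra_simps)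
    finally show ?thesis by (simp only: Qn)
  qed
  also have "(Q - 1) * (1 - A) * q ^ (x + 1) * y x =
      a * (b * q ^ (x + 1) / q - 1) * (y (x + 1) - y x) +
      ((q ^ (x + 1) - q) * phi_sum Q A a q n (q ^ (x + 1) / q) - (q ^ (x + 1) - q) * y x)"
    using phi_sum_q_difference[OF q a QA Qn, of "q ^ (x + 1)"]
    by (simp add: y_eq right_diff_distrib)
  also have "\<dots> = a * (b * q ^ x - 1) * (y (x + 1) - y x) + q * (q ^ x - 1) * (y (x - 1) - y x)"
    unfolding down using q by (simp add: algebra_simps)
  finally show ?thesis unfolding y_def A_def e_def .
qed

section \<open>Ratios of neighbouring values for x < n - 1\<close>

lemma tendsto_power_at_right_0: "0 < k \<Longrightarrow> ((\<lambda>q::real. q ^ k) \<longlongrightarrow> 0) (at_right 0)"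
  by (rule tendsto_eq_intros refl | simp)+

text \<open>Eliminating the value at \<open>x - 1\<close> from the q-difference equation leaves a
  two-term relation between the values at \<open>x\<close> and \<open>x + 1\<close>. The factor
  \<open>q ^ x - 1\<close> in the hypothesis makes it trivially true at \<open>x = 0\<close>, so one
  lemma serves both the start and the step of the induction.\<close>

lemma little_q_jacobi_ratio_step:
  assumes a: "a < 1" and x: "x + 1 < n" and r: "(r \<longlongrightarrow> 0) (at_right 0)"
    and ev: "\<forall>\<^sub>F q in at_right 0. (q ^ x - 1) * little_q_jacobi a b q n (x - 1) =
      (q ^ x - 1) * (r q * little_q_jacobi a b q n x)"
  shows "\<exists>r'. (r' \<longlongrightarrow> 0) (at_right 0) \<and>
    (\<forall>\<^sub>F q in at_right 0. little_q_jacobi a b q n x = r' q * little_q_jacobi a b q n (x + 1))"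
proof -
  define e :: "real \<Rightarrow> real" where "e q = q ^ (n - 1 - x)" for q
  \<comment> \<open>All multiples of the value at \<open>x\<close>, collected on the left-hand side
    after the elimination.\<close>
  define d where "d q = (1 - q ^ n) * (1 - a * b * q ^ (n - 1)) +
    e q * (a * (b * q ^ x - 1) + q * (q ^ x - 1) * (1 - r q))" for q
  define r' where "r' q = e q * (a * (b * q ^ x - 1)) / d q" for q
  have e0: "(e \<longlongrightarrow> 0) (at_right 0)"
    unfolding e_def using x by (intro tendsto_power_at_right_0) simp
  \<comment> \<open>Keeping the limit as \<open>0 ^ x\<close> covers both \<open>x = 0\<close> and
    \<open>x > 0\<close>; wherever it occurs, the factor \<open>e q\<close> removes it in the
    limit.\<close>
  have px: "((\<lambda>q::real. q ^ x) \<longlongrightarrow> 0 ^ x) (at_right 0)"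
    by (intro tendsto_intros)
  have d1: "(d \<longlongrightarrow> (1 - 0) * (1 - a * b * 0) +
      0 * (a * (b * 0 ^ x - 1) + 0 * (0 ^ x - 1) * (1 - 0))) (at_right 0)"
    unfolding d_def using x
    by (intro tendsto_intros tendsto_power_at_right_0 e0 px r) simp_all
  then have d1: "(d \<longlongrightarrow> 1) (at_right 0)" by simp
  have "(r' \<longlongrightarrow> 0 * (a * (b * 0 ^ x - 1)) / 1) (at_right 0)"
    unfolding r'_def by (intro tendsto_intros e0 px d1) simp
  then have r': "(r' \<longlongrightarrow> 0) (at_right 0)" by simp
  have "\<forall>\<^sub>F q in at_right 0. d q > 0"
    using order_tendstoD(1)[OF d1, of 0] by simp
  moreover have "\<forall>\<^sub>F q::real in at_right 0. 0 < q \<and> q < 1"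
    by (simp add: eventually_at_right_less eventually_conj_iff)
       (rule eventually_at_rightI[of 0 1], auto)
  ultimately have "\<forall>\<^sub>F q in at_right 0.
      little_q_jacobi a b q n x = r' q * little_q_jacobi a b q n (x + 1)"
    using ev
  proof (eventually_elim)
    case (elim q)
    let ?y = "little_q_jacobi a b q n"
    have "(1 - q ^ n) * (1 - a * b * q ^ (n - 1)) * ?y x =
      e q * (a * (b * q ^ x - 1) * (?y (x + 1) - ?y x) +
        q * ((q ^ x - 1) * ?y (x - 1) - (q ^ x - 1) * ?y x))"
      by (subst little_q_jacobi_q_difference) (use elim(2) a x in \<open>simp_all add: e_def algebra_simps\<close>)
    then have "d q * ?y x = e q * (a * (b * q ^ x - 1)) * ?y (x + 1)"
      unfolding elim(3) d_def by (simp add: algebra_simps)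
    then show ?case using elim(1) by (simp add: r'_def field_simps)
  qed
  with r' show ?thesis by blast
qed

lemma little_q_jacobi_ratio_tendsto_0:
  assumes a: "a < 1" and x: "x + 1 < n"
  shows "\<exists>r. (r \<longlongrightarrow> 0) (at_right 0) \<and>
    (\<forall>\<^sub>F q in at_right 0. little_q_jacobi a b q n x = r q * little_q_jacobi a b q n (x + 1))"
  using x
proof (induction x)
  case 0
  show ?case using little_q_jacobi_ratio_step[OF a 0, of "\<lambda>_. 0"] by simp
next
  case (Suc x)
  then obtain r where "(r \<longlongrightarrow> 0) (at_right 0)"
    "\<forall>\<^sub>F q in at_right 0. little_q_jacobi a b q n x = r q * little_q_jacobi a b q n (x + 1)"
    by auto
  then show ?case by (intro little_q_jacobi_ratio_step[OF a Suc.prems]) (auto elim: eventually_mono)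
qed

section \<open>The limit for x \<ge> n - 1\<close>

lemma q_pochhammer_neg_power:
  assumes "q \<noteq> 0"
  shows "q_pochhammer (q powi (- int n)) q k * q ^ (n * k) = (\<Prod>i<k. q ^ n - q ^ i)"
proof -
  have "(1 - q powi (- int n) * q ^ i) * q ^ n = q ^ n - q ^ i" for i
    using assms by (simp add: power_int_minus left_diff_distrib)
  moreover have "q ^ (n * k) = (\<Prod>i<k. q ^ n)"
    by (simp add: power_mult)
  ultimately show ?thesis
    by (simp only: q_pochhammer_def prod.distrib[symmetric])
qed

text \<open>As \<open>n \<le> x + 1\<close>, the power \<open>q ^ ((x + 1) * k)\<close> contains
  \<open>q ^ (n * k)\<close>, which gives one \<open>q ^ n\<close> to each of the \<open>k\<close>
  factors with a negative exponent. The result can be evaluated at \<open>q = 0\<close>.\<close>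

lemma little_q_jacobi_regular:
  assumes q: "q \<noteq> 0" and n: "1 \<le> n" "n \<le> x + 1"
  shows "little_q_jacobi a b q n x =
    (\<Sum>k\<le>n. (\<Prod>i<k. q ^ n - q ^ i) * q_pochhammer (a * b * q ^ (n - 1)) q k /
       (q_pochhammer a q k * q_pochhammer q q k) * q ^ ((x + 1 - n) * k))"
proof -
  have powi: "q powi (int n - 1) = q ^ (n - 1)"
    using n by (simp add: power_int_def nat_diff_distrib)
  have "n * k + (x + 1 - n) * k = (x + 1) * k" for k
    using n by (simp flip: add_mult_distrib)
  then have split: "q ^ ((x + 1) * k) = q ^ (n * k) * q ^ ((x + 1 - n) * k)" for k
    by (simp flip: power_add)
  show ?thesis
    unfolding little_q_jacobi_def powi split q_pochhammer_neg_power[OF q, symmetric]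
    by (intro sum.cong) (simp_all add: ac_simps)
qed

lemma q_pochhammer_at_0: "q_pochhammer c 0 k = (if k = 0 then 1 else 1 - c)"
  by (induction k) (auto simp: q_pochhammer_Suc)

text \<open>The factor \<open>i = 0\<close> is -1, since \<open>0 ^ 0 = 1\<close>, and the factor
  \<open>i = 1\<close> is 0.\<close>

lemma prod_power_diff_at_0:
  assumes "1 \<le> n"
  shows "(\<Prod>i<k. (0::real) ^ n - 0 ^ i) = (if k = 0 then 1 else if k = 1 then -1 else 0)"
proof (cases "k < 2")
  case True
  then show ?thesis using assms by (auto simp: less_2_cases_iff zero_power)
next
  case False
  then show ?thesis using assms by (auto simp: prod_zero_iff zero_power intro!: bexI[of _ 1])
qed

text \<open>The limit is the value at \<open>q = 0\<close> of the regular form. The power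
  \<open>0 ^ (n - 1)\<close> is 1 exactly for \<open>n = 1\<close>, the only case in which the limit
  depends on \<open>b\<close>.\<close>

lemma little_q_jacobi_regular_tendsto:
  assumes a: "a < 1" and n: "1 \<le> n" "n \<le> x + 1"
  shows "((\<lambda>q. little_q_jacobi a b q n x) \<longlongrightarrow>
    (if x + 1 = n then 1 - (1 - a * b * 0 ^ (n - 1)) / (1 - a) else 1)) (at_right 0)"
proof -
  define f where "f q k = (\<Prod>i<k. q ^ n - q ^ i) * q_pochhammer (a * b * q ^ (n - 1)) q k /
       (q_pochhammer a q k * q_pochhammer q q k) * q ^ ((x + 1 - n) * k)" for q :: real and k
  have "((\<lambda>q. f q k) \<longlongrightarrow> f 0 k) (at_right 0)" for k
    unfolding f_def q_pochhammer_def
  proof (intro tendsto_intros)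
    show "(\<Prod>i<k. 1 - a * 0 ^ i) * (\<Prod>i<k. 1 - 0 * 0 ^ i) \<noteq> (0::real)"
      using a q_pochhammer_at_0[of a k] by (auto simp: q_pochhammer_def)
  qed
  then have lim: "((\<lambda>q. \<Sum>k\<le>n. f q k) \<longlongrightarrow> (\<Sum>k\<le>n. f 0 k)) (at_right 0)"
    by (intro tendsto_sum)
  have "(\<Sum>k\<le>n. f 0 k) = (\<Sum>k\<in>{0, 1}. f 0 k)"
    using n by (intro sum.mono_neutral_right) (auto simp: f_def prod_power_diff_at_0)
  \<comment> \<open>The summand for \<open>k = 1\<close> carries \<open>0 ^ (x + 1 - n)\<close>, so
    it survives only when \<open>x + 1 = n\<close>.\<close>
  also have "\<dots> = (if x + 1 = n then 1 - (1 - a * b * 0 ^ (n - 1)) / (1 - a) else 1)"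
    using n by (auto simp: f_def prod_power_diff_at_0 q_pochhammer_at_0 zero_power
        diff_divide_distrib)
  finally have val: "(\<Sum>k\<le>n. f 0 k) =
    (if x + 1 = n then 1 - (1 - a * b * 0 ^ (n - 1)) / (1 - a) else 1)" .
  have "\<forall>\<^sub>F q in at_right 0. (\<Sum>k\<le>n. f q k) = little_q_jacobi a b q n x"
    using eventually_at_right_less[of "0::real"]
    by eventually_elim (use n in \<open>simp add: f_def little_q_jacobi_regular\<close>)
  with lim show ?thesis unfolding val by (rule Lim_transform_eventually)
qed

section \<open>Downward propagation and assembly of the cases\<close>

lemma little_q_jacobi_tendsto_0:
  assumes a: "a < 1" and x: "x + 1 < n"
  shows "((\<lambda>q. little_q_jacobi a b q n x) \<longlongrightarrow> 0) (at_right 0)"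
proof -
  have "x \<le> n - 1" using x by simp
  \<comment> \<open>The induction starts at \<open>x = n - 1\<close>, where the limit need not be 0.
    Convergence there is enough, since the ratio to the next lower value tends to 0.\<close>
  then have "\<exists>L. ((\<lambda>q. little_q_jacobi a b q n x) \<longlongrightarrow> L) (at_right 0) \<and> (x + 1 < n \<longrightarrow> L = 0)"
  proof (induction rule: inc_induct)
    case base
    show ?case using little_q_jacobi_regular_tendsto[OF a, of n "n - 1" b] x by auto
  next
    case (step m)
    then obtain L where L: "((\<lambda>q. little_q_jacobi a b q n (m + 1)) \<longlongrightarrow> L) (at_right 0)"
      by auto
    have "m + 1 < n" using step.hyps by simp
    from little_q_jacobi_ratio_tendsto_0[OF a this, of b] obtain r where r: "(r \<longlongrightarrow> 0) (at_right 0)"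
      and ev: "\<forall>\<^sub>F q in at_right 0. little_q_jacobi a b q n m = r q * little_q_jacobi a b q n (m + 1)"
      by blast
    have "((\<lambda>q. r q * little_q_jacobi a b q n (m + 1)) \<longlongrightarrow> 0) (at_right 0)"
      using tendsto_mult[OF r L] by simp
    then have "((\<lambda>q. little_q_jacobi a b q n m) \<longlongrightarrow> 0) (at_right 0)"
      by (rule Lim_transform_eventually) (use ev in \<open>simp add: eq_commute\<close>)
    then show ?case by blast
  qed
  then show ?thesis using x by blast
qed

lemma little_q_jacobi_tendsto:
  assumes "a < 1"
  shows "((\<lambda>q. little_q_jacobi a b q n x) \<longlongrightarrow>
    (if n = 0 \<or> n < x + 1 then 1 else if x + 1 < n then 0
     else 1 - (1 - a * b * 0 ^ (n - 1)) / (1 - a))) (at_right 0)"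
proof (cases "n = 0")
  case True
  then show ?thesis by (simp add: little_q_jacobi_def)
next
  case False
  then show ?thesis
    using little_q_jacobi_regular_tendsto[OF assms, of n x b]
      little_q_jacobi_tendsto_0[OF assms, of x n b]
    by (cases "x + 1 < n") auto
qed

theorem theorem2p1:
  fixes a b :: real
  assumes "0 < a" and "a < 1" and "b < 1"
  shows "(\<forall>n x. \<exists>L. ((\<lambda>q. little_q_jacobi a b q n x) \<longlongrightarrow> L) (at_right 0)) \<and>
    (\<forall>x. little_0_jacobi a b 0 x = 1) \<and>
    (\<forall>x. little_0_jacobi a b 1 x = (if x = 0 then - (a * (1 - b) / (1 - a)) else 1)) \<and>
    (\<forall>n\<ge>2. \<forall>x. little_0_jacobi a b n x =
       (if x < n - 1 then 0 else if x = n - 1 then - (a / (1 - a)) else 1))"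
proof -
  have limit: "little_0_jacobi a b n x =
    (if n = 0 \<or> n < x + 1 then 1 else if x + 1 < n then 0
     else 1 - (1 - a * b * 0 ^ (n - 1)) / (1 - a))" for n x
    unfolding little_0_jacobi_def
    by (rule tendsto_Lim[OF _ little_q_jacobi_tendsto[OF assms(2)]]) simp
  \<comment> \<open>The exceptional value \<open>1 - (1 - a * b * 0 ^ (n - 1)) / (1 - a)\<close>
    becomes \<open>- (a * (1 - b) / (1 - a))\<close> for \<open>n = 1\<close> and
    \<open>- (a / (1 - a))\<close> for \<open>n \<ge> 2\<close>.\<close>
  show ?thesis
    using assms little_q_jacobi_tendsto[OF assms(2)]
    by (auto simp: limit field_simps zero_power)
qed

end
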